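(* Let $\mathcal G=(G_n,\|\cdot\|_n)_{n\in\mathbb N}$ be a family of metric groups with $\sup\{\|g\|_n : n\in\mathbb N,\ g\in G_n\}<\infty$ and let $\mathcal U$ be a non-principal ultrafilter on $\mathbb N$. If $\mathcal G^*_{\mathrm{met}}$ is perfect, then $\mathcal G^*_{\mathrm{met}}$ is uniformly perfect, i.e. there is $N\in\mathbb N$ such that every element of $\mathcal G^*_{\mathrm{met}}$ is a product of $N$ commutators.
   Context: A metric group $(G,\|\cdot\|)$ is a group with a bi-invariant norm $\|\cdot\|\colon G\to[0,\infty]$: $\|e\|=0$, $\|gh\|\le\|g\|+\|h\|$, $\|g^{-1}\|=\|g\|=\|hgh^{-1}\|$, and $\|g\|=0$ iff $g=e$. The metric ultraproduct is $\mathcal G^*_{\mathrm{met}}=\prod_{n}G_n/\mathcal E$, where $\mathcal E=\{(g_n)\in\prod_n G_n : \lim_{n\to\mathcal U}\|g_n\|_n=0\}$. A group is perfect if every element is a product of commutators $[g,h]=g^{-1}h^{-1}gh$. *)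

theory Defs
  imports "HOL-Algebra.Product_Groups" "HOL-Analysis.Extended_Real_Limits"
begin

locale metric_group = group +
  fixes nrm :: "'a \<Rightarrow> ennreal"
  assumes nrm_eq_0_iff: "g \<in> carrier G \<Longrightarrow> nrm g = 0 \<longleftrightarrow> g = \<one>"
    and nrm_mult_le: "g \<in> carrier G \<Longrightarrow> h \<in> carrier G \<Longrightarrow> nrm (g \<otimes> h) \<le> nrm g + nrm h"
    and nrm_inv: "g \<in> carrier G \<Longrightarrow> nrm (inv g) = nrm g"
    and nrm_conj: "g \<in> carrier G \<Longrightarrow> h \<in> carrier G \<Longrightarrow> nrm (h \<otimes> g \<otimes> inv h) = nrm g"

text \<open>
  An ultrafilter on a set is represented by the type \<^typ>\<open>'a filter\<close>, where a set \<open>A\<close> belongs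
  to \<open>U\<close> iff \<open>eventually (\<lambda>x. x \<in> A) U\<close>.  As \<^typ>\<open>'a filter\<close> includes the improper filter
  \<^term>\<open>bot\<close>, properness is part of the definition.
\<close>

definition ultrafilter :: "'a filter \<Rightarrow> bool" where
  "ultrafilter U \<longleftrightarrow> U \<noteq> bot \<and> (\<forall>P. eventually P U \<or> eventually (\<lambda>x. \<not> P x) U)"

definition nonprincipal_ultrafilter :: "'a filter \<Rightarrow> bool" where
  "nonprincipal_ultrafilter U \<longleftrightarrow> ultrafilter U \<and> (\<forall>x. U \<noteq> principal {x})"

definition null_seqs ::
  "(nat \<Rightarrow> ('a, 'b) monoid_scheme) \<Rightarrow> (nat \<Rightarrow> 'a \<Rightarrow> ennreal) \<Rightarrow> nat filter \<Rightarrow> (nat \<Rightarrow> 'a) set" where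
  "null_seqs G nrm U = {g \<in> carrier (product_group UNIV G). ((\<lambda>n. nrm n (g n)) \<longlongrightarrow> 0) U}"

definition metric_ultraproduct ::
  "(nat \<Rightarrow> ('a, 'b) monoid_scheme) \<Rightarrow> (nat \<Rightarrow> 'a \<Rightarrow> ennreal) \<Rightarrow> nat filter \<Rightarrow> (nat \<Rightarrow> 'a) set monoid" where
  "metric_ultraproduct G nrm U = product_group UNIV G Mod null_seqs G nrm U"

definition commutator :: "('a, 'b) monoid_scheme \<Rightarrow> 'a \<Rightarrow> 'a \<Rightarrow> 'a" where
  "commutator G g h = inv\<^bsub>G\<^esub> g \<otimes>\<^bsub>G\<^esub> inv\<^bsub>G\<^esub> h \<otimes>\<^bsub>G\<^esub> g \<otimes>\<^bsub>G\<^esub> h"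

definition product_of_commutators :: "('a, 'b) monoid_scheme \<Rightarrow> nat \<Rightarrow> 'a \<Rightarrow> bool" where
  "product_of_commutators G N x \<longleftrightarrow>
     (\<exists>cs. length cs = N \<and>
        (\<forall>c \<in> set cs. \<exists>g \<in> carrier G. \<exists>h \<in> carrier G. c = commutator G g h) \<and>
        x = foldr (\<otimes>\<^bsub>G\<^esub>) cs \<one>\<^bsub>G\<^esub>)"

definition perfect_group :: "('a, 'b) monoid_scheme \<Rightarrow> bool" where
  "perfect_group G \<longleftrightarrow> (\<forall>x \<in> carrier G. \<exists>N. product_of_commutators G N x)"

definition uniformly_perfect_group :: "('a, 'b) monoid_scheme \<Rightarrow> bool" where
  "uniformly_perfect_group G \<longleftrightarrow> (\<exists>N. \<forall>x \<in> carrier G. product_of_commutators G N x)"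

lemma null_seqs_normal:
  assumes mg: "\<And>n. metric_group (G n) (nrm n)"
  shows "null_seqs G nrm U \<lhd> product_group UNIV G"
proof -
  have gr: "group (G n)" for n
    using mg by (simp add: metric_group_def)
  interpret P: group "product_group UNIV G"
    by (simp add: gr)
  have clo: "x n \<in> carrier (G n)" if "x \<in> carrier (product_group UNIV G)" for x n
    using that by (auto simp: PiE_iff)
  have mult: "x \<otimes>\<^bsub>product_group UNIV G\<^esub> y \<in> null_seqs G nrm U"
    if x: "x \<in> null_seqs G nrm U" and y: "y \<in> null_seqs G nrm U" for x y
  proof -
    have xy: "x \<in> carrier (product_group UNIV G)" "y \<in> carrier (product_group UNIV G)"
      using x y by (auto simp: null_seqs_def)
    have "((\<lambda>n. nrm n (x n) + nrm n (y n)) \<longlongrightarrow> 0 + 0) U"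
      using x y unfolding null_seqs_def by (intro tendsto_add) auto
    then have lim: "((\<lambda>n. nrm n (x n) + nrm n (y n)) \<longlongrightarrow> 0) U"
      by simp
    have "((\<lambda>n. nrm n (x n \<otimes>\<^bsub>G n\<^esub> y n)) \<longlongrightarrow> 0) U"
    proof (rule tendsto_sandwich[OF _ _ tendsto_const lim])
      show "\<forall>\<^sub>F n in U. nrm n (x n \<otimes>\<^bsub>G n\<^esub> y n) \<le> nrm n (x n) + nrm n (y n)"
        by (rule always_eventually, rule allI,
            rule metric_group.nrm_mult_le[OF mg clo[OF xy(1)] clo[OF xy(2)]])
    qed simp
    with P.m_closed[OF xy] show ?thesis
      by (simp add: null_seqs_def)
  qed
  have inv: "inv\<^bsub>product_group UNIV G\<^esub> x \<in> null_seqs G nrm U"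
    if x: "x \<in> null_seqs G nrm U" for x
  proof -
    have xc: "x \<in> carrier (product_group UNIV G)"
      using x by (auto simp: null_seqs_def)
    then have "inv\<^bsub>product_group UNIV G\<^esub> x = (\<lambda>n. inv\<^bsub>G n\<^esub> x n)"
      by (subst inv_product_group) (auto simp: gr)
    with P.inv_closed[OF xc] x show ?thesis
      by (simp add: null_seqs_def metric_group.nrm_inv[OF mg] clo[OF xc])
  qed
  have conj: "x \<otimes>\<^bsub>product_group UNIV G\<^esub> h \<otimes>\<^bsub>product_group UNIV G\<^esub> inv\<^bsub>product_group UNIV G\<^esub> x
      \<in> null_seqs G nrm U"
    if x: "x \<in> carrier (product_group UNIV G)" and h: "h \<in> null_seqs G nrm U" for x h
  proof -
    have hc: "h \<in> carrier (product_group UNIV G)"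
      using h by (auto simp: null_seqs_def)
    have iv: "inv\<^bsub>product_group UNIV G\<^esub> x = (\<lambda>n. inv\<^bsub>G n\<^esub> x n)"
      using x by (subst inv_product_group) (auto simp: gr)
    have "x \<otimes>\<^bsub>product_group UNIV G\<^esub> h \<otimes>\<^bsub>product_group UNIV G\<^esub> inv\<^bsub>product_group UNIV G\<^esub> x
        \<in> carrier (product_group UNIV G)"
      using x hc by (intro P.m_closed P.inv_closed)
    then show ?thesis
      using h by (simp add: null_seqs_def iv metric_group.nrm_conj[OF mg] clo[OF x] clo[OF hc])
  qed
  have one: "\<one>\<^bsub>product_group UNIV G\<^esub> \<in> null_seqs G nrm U"
  proof -
    have "nrm n \<one>\<^bsub>G n\<^esub> = 0" for n
      using metric_group.nrm_eq_0_iff[OF mg monoid.one_closed[OF group.is_monoid[OF gr]]] by simp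
    with P.one_closed show ?thesis
      by (simp add: null_seqs_def)
  qed
  have "subgroup (null_seqs G nrm U) (product_group UNIV G)"
    using mult inv one by (intro subgroup.intro) (auto simp: null_seqs_def)
  with conj show ?thesis
    by (simp add: P.normal_inv_iff)
qed

lemma group_metric_ultraproduct:
  assumes "\<And>n. metric_group (G n) (nrm n)"
  shows "group (metric_ultraproduct G nrm U)"
  unfolding metric_ultraproduct_def
  by (intro normal.factorgroup_is_group null_seqs_normal assms)

end

theory Submission
  imports Defs
begin

text \<open>
  Call \<open>W\<^sub>N\<close> the set of products of \<open>N\<close> commutators. Saturation of the ultraproduct identifies
  \<open>W\<^sub>N\<close> of the ultraproduct with the classes of sequences whose distance to \<open>W\<^sub>N(G n)\<close> tends to
  \<open>0\<close>, and it forbids a sequence of points \<open>x\<^sub>k\<close> that stay at a fixed positive distance \<open>\<rho>\<^sub>j\<close> from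
  \<open>W\<^sub>j\<close> for all \<open>j \<le> k\<close>: a diagonal point would then lie in no \<open>W\<^sub>j\<close>. If no \<open>W\<^sub>N\<close> contains a
  ball around the identity, nested balls as in Baire's theorem give such a sequence. If \<open>W\<^sub>N\<close>
  contains the ball of radius \<open>r\<close>, then a point outside \<open>W\<^bsub>j+N\<^esub>\<close> has distance at least \<open>r\<close> from
  \<open>W\<^sub>j\<close>, so failure of uniform perfectness gives such a sequence with constant \<open>\<rho>\<^sub>j\<close>.
\<close>

section \<open>Products of commutators\<close>

context group
begin

lemma commutator_closed [simp]:
  "g \<in> carrier G \<Longrightarrow> h \<in> carrier G \<Longrightarrow> commutator G g h \<in> carrier G"
  by (simp add: commutator_def)

lemma inv_commutator:
  "g \<in> carrier G \<Longrightarrow> h \<in> carrier G \<Longrightarrow> inv (commutator G g h) = commutator G h g"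
  by (simp add: commutator_def inv_mult_group m_assoc)

lemma product_of_commutators_0 [simp]: "product_of_commutators G 0 x \<longleftrightarrow> x = \<one>"
  by (simp add: product_of_commutators_def)

lemma product_of_commutators_Suc:
  "product_of_commutators G (Suc N) x \<longleftrightarrow>
    (\<exists>g \<in> carrier G. \<exists>h \<in> carrier G. \<exists>y. product_of_commutators G N y \<and>
      x = commutator G g h \<otimes> y)"
  (is "?L \<longleftrightarrow> ?R")
proof
  assume ?L
  then obtain cs where cs: "length cs = Suc N"
      "\<forall>c \<in> set cs. \<exists>g \<in> carrier G. \<exists>h \<in> carrier G. c = commutator G g h"
      "x = foldr (\<otimes>) cs \<one>"
    by (auto simp: product_of_commutators_def)
  then obtain c ds where "cs = c # ds" by (cases cs) auto
  with cs show ?R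
    by (fastforce simp: product_of_commutators_def)
next
  assume ?R
  then obtain g h cs where gh: "g \<in> carrier G" "h \<in> carrier G" and cs: "length cs = N"
      "\<forall>c \<in> set cs. \<exists>g \<in> carrier G. \<exists>h \<in> carrier G. c = commutator G g h"
      "x = commutator G g h \<otimes> foldr (\<otimes>) cs \<one>"
    by (auto simp: product_of_commutators_def)
  then show ?L
    unfolding product_of_commutators_def
    by (intro exI[of _ "commutator G g h # cs"]) auto
qed

lemma product_of_commutators_closed:
  "product_of_commutators G N x \<Longrightarrow> x \<in> carrier G"
  by (induction N arbitrary: x) (auto simp: product_of_commutators_Suc)

lemma product_of_commutators_mult:
  assumes "product_of_commutators G M x" "product_of_commutators G N y"
  shows "product_of_commutators G (M + N) (x \<otimes> y)"
  using assms
proof (induction M arbitrary: x)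
  case 0
  then show ?case by (simp add: product_of_commutators_closed)
next
  case (Suc M)
  then obtain g h z where "g \<in> carrier G" "h \<in> carrier G"
      "product_of_commutators G M z" "x = commutator G g h \<otimes> z"
    by (auto simp: product_of_commutators_Suc)
  moreover have "product_of_commutators G (M + N) (z \<otimes> y)"
    using Suc calculation by blast
  ultimately show ?case
    using Suc.prems(2)
    by (auto simp: product_of_commutators_Suc m_assoc product_of_commutators_closed)
qed

lemma product_of_commutators_1:
  "g \<in> carrier G \<Longrightarrow> h \<in> carrier G \<Longrightarrow> product_of_commutators G (Suc 0) (commutator G g h)"
  by (auto simp: product_of_commutators_Suc intro!: bexI)

lemma product_of_commutators_one: "product_of_commutators G N \<one>"
proof (induction N)
  case (Suc N)
  then show ?case
    by (auto simp: product_of_commutators_Suc commutator_def intro!: bexI[of _ \<one>])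
qed simp

lemma product_of_commutators_mono:
  assumes "product_of_commutators G M x" "M \<le> N"
  shows "product_of_commutators G N x"
  using product_of_commutators_mult[OF assms(1) product_of_commutators_one[of "N - M"]] assms
  by (simp add: product_of_commutators_closed)

lemma product_of_commutators_inv:
  assumes "product_of_commutators G N x"
  shows "product_of_commutators G N (inv x)"
  using assms
proof (induction N arbitrary: x)
  case (Suc N)
  then obtain g h y where *: "g \<in> carrier G" "h \<in> carrier G"
      "product_of_commutators G N y" "x = commutator G g h \<otimes> y"
    by (auto simp: product_of_commutators_Suc)
  \<comment> \<open>Inversion moves the leading commutator to the end and swaps its two arguments,
    so the number of factors stays the same.\<close>
  have "product_of_commutators G (N + Suc 0) (inv y \<otimes> commutator G h g)"
    using * Suc.IH by (intro product_of_commutators_mult product_of_commutators_1) auto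
  with * show ?case
    by (simp add: inv_mult_group product_of_commutators_closed inv_commutator)
qed simp

end

lemma (in group_hom) hom_commutator:
  "x \<in> carrier G \<Longrightarrow> y \<in> carrier G \<Longrightarrow> h (commutator G x y) = commutator H (h x) (h y)"
  by (simp add: commutator_def)

lemma (in group_hom) product_of_commutators_surj:
  assumes "h ` carrier G = carrier H"
  shows "product_of_commutators H N y \<longleftrightarrow> (\<exists>x. product_of_commutators G N x \<and> y = h x)"
proof (induction N arbitrary: y)
  case (Suc N)
  show ?case (is "?L \<longleftrightarrow> ?R")
  proof
    assume ?L
    then obtain a b z where "a \<in> carrier H" "b \<in> carrier H" "product_of_commutators H N z"
        and y: "y = commutator H a b \<otimes>\<^bsub>H\<^esub> z"
      by (auto simp: H.product_of_commutators_Suc)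
    moreover obtain z' where "product_of_commutators G N z'" "z = h z'"
      using Suc calculation(3) by blast
    ultimately obtain a' b' where *: "a' \<in> carrier G" "b' \<in> carrier G"
        "product_of_commutators G N z'" "a = h a'" "b = h b'" "z = h z'"
      unfolding assms[symmetric] by blast
    then have "y = h (commutator G a' b' \<otimes> z')"
      using y by (simp add: hom_commutator G.product_of_commutators_closed)
    with * show ?R
      unfolding G.product_of_commutators_Suc by blast
  next
    assume ?R
    then obtain a b z where *: "a \<in> carrier G" "b \<in> carrier G" "product_of_commutators G N z"
        and y: "y = h (commutator G a b \<otimes> z)"
      by (auto simp: G.product_of_commutators_Suc)
    have "product_of_commutators H N (h z)" using Suc * by blast
    moreover have "y = commutator H (h a) (h b) \<otimes>\<^bsub>H\<^esub> h z"
      using * y by (simp add: hom_commutator G.product_of_commutators_closed)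
    ultimately show ?L
      unfolding H.product_of_commutators_Suc using * hom_closed by blast
  qed
qed auto

text \<open>The same \<open>N\<close> serves all coordinates, so the factors can be chosen
  coordinate by coordinate and assembled into \<open>N\<close> commutators of sequences. With a
  number of factors depending on \<open>i\<close> this assembly would break down.\<close>

lemma product_of_commutators_product_group:
  assumes gr: "\<And>i. group (G i)"
  shows "product_of_commutators (product_group UNIV G) N x \<longleftrightarrow>
    (\<forall>i. product_of_commutators (G i) N (x i))"
proof (induction N arbitrary: x)
  case 0
  interpret P: group "product_group UNIV G" by (simp add: gr)
  show ?case
    by (simp add: group.product_of_commutators_0[OF gr] fun_eq_iff)
next
  case (Suc N)
  interpret P: group "product_group UNIV G" by (simp add: gr)
  have comm: "commutator (product_group UNIV G) a b = (\<lambda>i. commutator (G i) (a i) (b i))"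
    if "a \<in> carrier (product_group UNIV G)" "b \<in> carrier (product_group UNIV G)" for a b
    using that by (simp add: commutator_def gr restrict_UNIV)
  show ?case (is "?L \<longleftrightarrow> ?R")
  proof
    assume ?L
    then obtain a b z where *: "a \<in> carrier (product_group UNIV G)"
        "b \<in> carrier (product_group UNIV G)" "product_of_commutators (product_group UNIV G) N z"
        and x: "x = commutator (product_group UNIV G) a b \<otimes>\<^bsub>product_group UNIV G\<^esub> z"
      unfolding P.product_of_commutators_Suc by blast
    have "product_of_commutators (G i) N (z i)" for i using * Suc by blast
    then show ?R
      using * x comm unfolding group.product_of_commutators_Suc[OF gr]
      by (auto simp: PiE_iff intro!: bexI)
  next
    assume ?R
    then have "\<forall>i. \<exists>g h y. g \<in> carrier (G i) \<and> h \<in> carrier (G i) \<and>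
        product_of_commutators (G i) N y \<and> x i = commutator (G i) g h \<otimes>\<^bsub>G i\<^esub> y"
      unfolding group.product_of_commutators_Suc[OF gr] by blast
    then obtain a b z where *: "\<And>i. a i \<in> carrier (G i)" "\<And>i. b i \<in> carrier (G i)"
        "\<And>i. product_of_commutators (G i) N (z i)"
        "\<And>i. x i = commutator (G i) (a i) (b i) \<otimes>\<^bsub>G i\<^esub> z i"
      by metis
    then have ab: "a \<in> carrier (product_group UNIV G)" "b \<in> carrier (product_group UNIV G)"
      by auto
    have "x = commutator (product_group UNIV G) a b \<otimes>\<^bsub>product_group UNIV G\<^esub> z"
      using * by (auto simp: comm[OF ab])
    with ab Suc * show ?L
      unfolding P.product_of_commutators_Suc by blast
  qed
qed

section \<open>Diagonal sequences along an ultrafilter\<close>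

text \<open>The points below \<open>k\<close> are removed one at a time: if a singleton
  \<open>{k}\<close> belonged to \<open>U\<close>, then \<open>U\<close> would be the principal
  filter at \<open>k\<close>.\<close>

lemma nonprincipal_ultrafilter_eventually_ge:
  fixes U :: "nat filter"
  assumes "nonprincipal_ultrafilter U"
  shows "eventually (\<lambda>n. k \<le> n) U"
proof (induction k)
  case (Suc k)
  have "\<not> eventually (\<lambda>n. n = k) U"
  proof
    assume ev: "eventually (\<lambda>n. n = k) U"
    have "eventually Q U \<longleftrightarrow> Q k" for Q
    proof
      assume "eventually Q U"
      with ev have "eventually (\<lambda>n. Q k) U"
        by eventually_elim simp
      then show "Q k"
        using assms by (cases "Q k") (auto simp: nonprincipal_ultrafilter_def ultrafilter_def)
    next
      assume "Q k"
      with ev show "eventually Q U" by (auto elim: eventually_mono)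
    qed
    then have "U = principal {k}"
      by (simp add: filter_eq_iff eventually_principal)
    with assms show False by (simp add: nonprincipal_ultrafilter_def)
  qed
  then have "eventually (\<lambda>n. n \<noteq> k) U"
    using assms unfolding nonprincipal_ultrafilter_def ultrafilter_def by blast
  with Suc show ?case by eventually_elim simp
qed simp

text \<open>This is the form of countable saturation used below. If the choice of index
  \<open>k\<close> meets the conditions 0, ..., k on a set in \<open>U\<close>, then letting the
  index vary with \<open>n\<close> meets every condition on a set in \<open>U\<close>.\<close>

lemma nonprincipal_ultrafilter_diagonal:
  fixes U :: "nat filter" and Q :: "nat \<Rightarrow> nat \<Rightarrow> nat \<Rightarrow> bool"
  assumes U: "nonprincipal_ultrafilter U"
    and Q: "\<And>j k. j \<le> k \<Longrightarrow> eventually (\<lambda>n. Q j k n) U"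
  obtains K where "\<And>j. eventually (\<lambda>n. Q j (K n) n) U"
proof
  \<comment> \<open>The index at \<open>n\<close> will be the largest stage all of whose conditions
    hold at \<open>n\<close>. The bound \<open>k \<le> n\<close> keeps the set finite; it may be
    empty for some \<open>n\<close>, but for each \<open>j\<close> it contains \<open>j\<close> for
    \<open>U\<close>-almost all \<open>n\<close>.\<close>
  define S where "S n = {k. k \<le> n \<and> (\<forall>j\<le>k. Q j k n)}" for n
  have fin: "finite (S n)" for n
    by (rule finite_subset[of _ "{..n}"]) (auto simp: S_def)
  fix j
  have "eventually (\<lambda>n. j \<le> n) U"
    by (rule nonprincipal_ultrafilter_eventually_ge[OF U])
  moreover have "eventually (\<lambda>n. \<forall>i\<in>{..j}. Q i j n) U"
    using Q by (intro eventually_ball_finite) auto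
  ultimately show "eventually (\<lambda>n. Q j (Max (S n)) n) U"
  proof eventually_elim
    case (elim n)
    then have "j \<in> S n" by (auto simp: S_def)
    then have "j \<le> Max (S n)" "Max (S n) \<in> S n"
      using fin by (auto intro: Max_in)
    then show ?case by (auto simp: S_def)
  qed
qed

section \<open>The invariant distance\<close>

locale finite_metric_group = metric_group +
  assumes nrm_finite: "g \<in> carrier G \<Longrightarrow> nrm g < \<infinity>"
begin

text \<open>Finiteness of the norm means that \<open>enn2real\<close> loses nothing here, and real
  values turn the later estimates into linear arithmetic.\<close>

definition gdist :: "'a \<Rightarrow> 'a \<Rightarrow> real" where
  "gdist x y = enn2real (nrm (x \<otimes> inv y))"

lemma nrm_eq_ennreal_gdist:
  "x \<in> carrier G \<Longrightarrow> y \<in> carrier G \<Longrightarrow> nrm (x \<otimes> inv y) = ennreal (gdist x y)"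
  using nrm_finite[of "x \<otimes> inv y"] by (simp add: gdist_def)

lemma gdist_nonneg: "gdist x y \<ge> 0"
  by (simp add: gdist_def)

lemma gdist_commute: "x \<in> carrier G \<Longrightarrow> y \<in> carrier G \<Longrightarrow> gdist x y = gdist y x"
  using nrm_inv[of "x \<otimes> inv y"] by (simp add: gdist_def inv_mult_group)

lemma gdist_self [simp]: "x \<in> carrier G \<Longrightarrow> gdist x x = 0"
  using nrm_eq_0_iff[of \<one>] by (simp add: gdist_def)

lemma gdist_triangle:
  assumes "x \<in> carrier G" "y \<in> carrier G" "z \<in> carrier G"
  shows "gdist x z \<le> gdist x y + gdist y z"
proof -
  have "inv y \<otimes> (y \<otimes> inv z) = inv z"
    using assms by (simp flip: m_assoc)
  then have "x \<otimes> inv z = (x \<otimes> inv y) \<otimes> (y \<otimes> inv z)"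
    using assms by (simp add: m_assoc)
  then have "ennreal (gdist x z) \<le> ennreal (gdist x y) + ennreal (gdist y z)"
    using nrm_mult_le[of "x \<otimes> inv y" "y \<otimes> inv z"] assms
    by (simp add: nrm_eq_ennreal_gdist[symmetric])
  then show ?thesis
    by (simp add: gdist_nonneg flip: ennreal_plus)
qed

end

section \<open>The ultraproduct\<close>

locale finite_metric_group_seq =
  fixes G :: "nat \<Rightarrow> ('a, 'b) monoid_scheme"
    and nrm :: "nat \<Rightarrow> 'a \<Rightarrow> ennreal"
    and U :: "nat filter"
  assumes finite_metric_group: "\<And>n. finite_metric_group (G n) (nrm n)"
    and nonprincipal: "nonprincipal_ultrafilter U"
begin

sublocale component: finite_metric_group "G n" "nrm n" for n
  by (rule finite_metric_group)

sublocale P: group "product_group UNIV G"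
  by (simp add: component.is_group)

sublocale null: normal "null_seqs G nrm U" "product_group UNIV G"
  by (intro null_seqs_normal component.metric_group_axioms)

abbreviation cls :: "(nat \<Rightarrow> 'a) \<Rightarrow> (nat \<Rightarrow> 'a) set" where
  "cls x \<equiv> null_seqs G nrm U #>\<^bsub>product_group UNIV G\<^esub> x"

abbreviation dst :: "nat \<Rightarrow> 'a \<Rightarrow> 'a \<Rightarrow> real" where
  "dst n \<equiv> finite_metric_group.gdist (G n) (nrm n)"

sublocale cls: group_hom "product_group UNIV G" "metric_ultraproduct G nrm U" cls
proof (intro group_hom.intro group_hom_axioms.intro)
  show "group (metric_ultraproduct G nrm U)"
    by (intro group_metric_ultraproduct component.metric_group_axioms)
  show "cls \<in> hom (product_group UNIV G) (metric_ultraproduct G nrm U)"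
    unfolding metric_ultraproduct_def by (rule null.r_coset_hom_Mod)
qed (rule P.is_group)

lemma cls_surj: "cls ` carrier (product_group UNIV G) = carrier (metric_ultraproduct G nrm U)"
  by (auto simp: metric_ultraproduct_def FactGroup_def RCOSETS_def)

lemma component_closed: "x \<in> carrier (product_group UNIV G) \<Longrightarrow> x n \<in> carrier (G n)"
  by (auto simp: PiE_iff)

lemma eventually_not_iff: "eventually (\<lambda>n. \<not> Q n) U \<longleftrightarrow> \<not> eventually Q U"
proof
  assume ev: "eventually (\<lambda>n. \<not> Q n) U"
  show "\<not> eventually Q U"
  proof
    assume "eventually Q U"
    with ev have "eventually (\<lambda>n. False) U" by eventually_elim simp
    then show False
      using nonprincipal by (simp add: nonprincipal_ultrafilter_def ultrafilter_def)
  qed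
qed (use nonprincipal in \<open>auto simp: nonprincipal_ultrafilter_def ultrafilter_def\<close>)

text \<open>Two cosets agree iff the quotient of their representatives is a null sequence; as norms
  are finite, its limit in \<open>ennreal\<close> can be rewritten as a real one.\<close>

lemma cls_eq_iff:
  assumes x: "x \<in> carrier (product_group UNIV G)" and y: "y \<in> carrier (product_group UNIV G)"
  shows "cls x = cls y \<longleftrightarrow> (\<forall>\<epsilon>>0. eventually (\<lambda>n. dst n (x n) (y n) < \<epsilon>) U)"
proof -
  let ?z = "x \<otimes>\<^bsub>product_group UNIV G\<^esub> inv\<^bsub>product_group UNIV G\<^esub> y"
  have iv: "inv\<^bsub>product_group UNIV G\<^esub> y = (\<lambda>n. inv\<^bsub>G n\<^esub> y n)"
    using y by (subst inv_product_group) (auto simp: component.is_group)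
  have "cls x = cls y \<longleftrightarrow> x \<in> cls y"
    using x y P.repr_independence[OF _ y null.is_subgroup] P.rcos_self[OF x null.is_subgroup]
    by auto
  also have "\<dots> \<longleftrightarrow> ?z \<in> null_seqs G nrm U"
    by (rule null.rcos_module[OF P.is_group y x])
  also have "\<dots> \<longleftrightarrow> ((\<lambda>n. nrm n (?z n)) \<longlongrightarrow> 0) U"
    using P.m_closed[OF x P.inv_closed[OF y]] by (simp add: null_seqs_def)
  also have "(\<lambda>n. nrm n (?z n)) = (\<lambda>n. ennreal (dst n (x n) (y n)))"
    using x y by (simp add: iv component.nrm_eq_ennreal_gdist component_closed)
  also have "((\<lambda>n. ennreal (dst n (x n) (y n))) \<longlongrightarrow> 0) U \<longleftrightarrow> ((\<lambda>n. dst n (x n) (y n)) \<longlongrightarrow> 0) U"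
    using tendsto_ennreal_iff[of "\<lambda>n. dst n (x n) (y n)" U 0] by (simp add: component.gdist_nonneg)
  also have "\<dots> \<longleftrightarrow> (\<forall>\<epsilon>>0. eventually (\<lambda>n. dst n (x n) (y n) < \<epsilon>) U)"
    by (simp add: tendsto_iff dist_real_def component.gdist_nonneg)
  finally show ?thesis .
qed

section \<open>Membership in W_N and distance from W_N in the components\<close>

abbreviation near :: "nat \<Rightarrow> (nat \<Rightarrow> 'a) \<Rightarrow> bool" where
  "near N x \<equiv> product_of_commutators (metric_ultraproduct G nrm U) N (cls x)"

definition far :: "nat \<Rightarrow> real \<Rightarrow> (nat \<Rightarrow> 'a) \<Rightarrow> nat \<Rightarrow> bool" where
  "far N \<rho> x n \<longleftrightarrow> (\<forall>w. product_of_commutators (G n) N w \<longrightarrow> \<rho> \<le> dst n w (x n))"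

lemma near_iff_representative:
  "near N x \<longleftrightarrow> (\<exists>w. (\<forall>n. product_of_commutators (G n) N (w n)) \<and> cls x = cls w)"
  unfolding cls.product_of_commutators_surj[OF cls_surj]
    product_of_commutators_product_group[of G, OF component.is_group] ..

lemma representative_closed:
  "(\<And>n. product_of_commutators (G n) N (w n)) \<Longrightarrow> w \<in> carrier (product_group UNIV G)"
  by (auto intro: component.product_of_commutators_closed)

lemma not_near_if_far:
  assumes x: "x \<in> carrier (product_group UNIV G)" and "\<rho> > 0" and far: "eventually (far N \<rho> x) U"
  shows "\<not> near N x"
proof
  assume "near N x"
  then obtain w where w: "\<And>n. product_of_commutators (G n) N (w n)" "cls x = cls w"
    unfolding near_iff_representative by blast
  then have "eventually (\<lambda>n. dst n (w n) (x n) < \<rho>) U"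
    using cls_eq_iff[OF representative_closed[OF w(1)] x] \<open>\<rho> > 0\<close> by auto
  with far have "eventually (\<lambda>n. False) U"
    by eventually_elim (use w(1) in \<open>auto simp: far_def not_le[symmetric]\<close>)
  then show False
    using nonprincipal by (simp add: nonprincipal_ultrafilter_def ultrafilter_def)
qed

text \<open>In other words, W_N of the ultraproduct is closed. If \<open>x\<close> had no positive
  distance from W_N, there would be approximations within 1/(j+1) for every \<open>j\<close>, and
  diagonalizing them gives one sequence in W_N with the same class as \<open>x\<close>.\<close>

lemma far_if_not_near:
  assumes x: "x \<in> carrier (product_group UNIV G)" and "\<not> near N x"
  obtains \<rho> where "\<rho> > 0" "eventually (far N \<rho> x) U"
proof (rule ccontr)
  assume "\<not> thesis"
  with that have "\<not> eventually (far N (inverse (real (Suc j))) x) U" for j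
    by fastforce
  then have *: "eventually (\<lambda>n. \<not> far N (inverse (real (Suc j))) x n) U" for j
    by (simp add: eventually_not_iff)
  have "\<forall>j n. \<exists>w. \<not> far N (inverse (real (Suc j))) x n \<longrightarrow>
      product_of_commutators (G n) N w \<and> dst n w (x n) < inverse (real (Suc j))"
    by (auto simp: far_def not_le)
  then obtain w where w: "\<And>j n. \<not> far N (inverse (real (Suc j))) x n \<Longrightarrow>
      product_of_commutators (G n) N (w j n) \<and> dst n (w j n) (x n) < inverse (real (Suc j))"
    by metis
  \<comment> \<open>The \<open>k\<close>-th approximation is tested against the tolerance of stage
    \<open>j\<close>; it passes for \<open>j \<le> k\<close> because the tolerances
    decrease.\<close>
  define Q where "Q j k n \<longleftrightarrow> product_of_commutators (G n) N (w k n) \<and>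
      dst n (w k n) (x n) < inverse (real (Suc j))" for j k n
  have "eventually (Q j k) U" if "j \<le> k" for j k
    using *[of k]
  proof eventually_elim
    case (elim n)
    have "inverse (real (Suc k)) \<le> inverse (real (Suc j))"
      using that by (simp add: field_simps)
    with w[OF elim] show ?case unfolding Q_def by linarith
  qed
  then obtain K where K: "\<And>j. eventually (\<lambda>n. Q j (K n) n) U"
    using nonprincipal_ultrafilter_diagonal[OF nonprincipal, of Q] by blast
  \<comment> \<open>A representative must lie in W_N(G n) in every coordinate, so the identity is
    used where the diagonal choice fails.\<close>
  define v where
    "v n = (if product_of_commutators (G n) N (w (K n) n) then w (K n) n else \<one>\<^bsub>G n\<^esub>)" for n
  have v: "product_of_commutators (G n) N (v n)" for n
    by (simp add: v_def component.product_of_commutators_one)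
  have "eventually (\<lambda>n. dst n (v n) (x n) < \<epsilon>) U" if pos: "\<epsilon> > 0" for \<epsilon>
  proof -
    obtain j where "inverse (real (Suc j)) < \<epsilon>"
      using reals_Archimedean[OF pos] by blast
    with K[of j] show ?thesis
      by (auto simp: Q_def v_def elim!: eventually_mono)
  qed
  then have "cls v = cls x"
    using cls_eq_iff[OF representative_closed[OF v] x] by blast
  with v have "near N x" unfolding near_iff_representative by metis
  with \<open>\<not> near N x\<close> show False by simp
qed

text \<open>The diagonal point takes its \<open>n\<close>-th coordinate from \<open>x (K n)\<close>
  and is far from every W_j at once. Since \<open>\<rho> j\<close> is independent of
  \<open>k\<close>, the bound survives the diagonalization and the class lies in no W_j.\<close>

lemma not_perfect_if_far:
  assumes x: "\<And>k. x k \<in> carrier (product_group UNIV G)"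
    and \<rho>: "\<And>j. \<rho> j > 0"
    and far: "\<And>j k. j \<le> k \<Longrightarrow> eventually (far j (\<rho> j) (x k)) U"
  shows "\<not> perfect_group (metric_ultraproduct G nrm U)"
proof
  assume perfect: "perfect_group (metric_ultraproduct G nrm U)"
  obtain K where K: "\<And>j. eventually (\<lambda>n. far j (\<rho> j) (x (K n)) n) U"
    using nonprincipal_ultrafilter_diagonal[OF nonprincipal, of "\<lambda>j k. far j (\<rho> j) (x k)"] far
    by blast
  define y where "y n = x (K n) n" for n
  have y: "y \<in> carrier (product_group UNIV G)"
    using component_closed[OF x] by (auto simp: y_def)
  have "\<not> near j y" for j
  proof (rule not_near_if_far[OF y \<rho>])
    show "eventually (far j (\<rho> j) y) U"
      using K[of j] by eventually_elim (simp add: far_def y_def)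
  qed
  moreover have "cls y \<in> carrier (metric_ultraproduct G nrm U)"
    using y by (rule cls.hom_closed)
  ultimately show False
    using perfect by (auto simp: perfect_group_def)
qed

section \<open>Balls inside some W_N, and uniform perfectness\<close>

lemma near_mult:
  assumes "near M x" "near N y" "x \<in> carrier (product_group UNIV G)" "y \<in> carrier (product_group UNIV G)"
  shows "near (M + N) (x \<otimes>\<^bsub>product_group UNIV G\<^esub> y)"
  using cls.H.product_of_commutators_mult[OF assms(1,2)] cls.hom_mult[OF assms(3,4)] by simp

lemma near_inv:
  assumes "near N x" "x \<in> carrier (product_group UNIV G)"
  shows "near N (inv\<^bsub>product_group UNIV G\<^esub> x)"
  using cls.H.product_of_commutators_inv[OF assms(1)] cls.hom_inv[OF assms(2)] by simp

lemma mult_inv_component: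
  assumes "x \<in> carrier (product_group UNIV G)" "y \<in> carrier (product_group UNIV G)"
  shows "(x \<otimes>\<^bsub>product_group UNIV G\<^esub> inv\<^bsub>product_group UNIV G\<^esub> y) n
    = x n \<otimes>\<^bsub>G n\<^esub> inv\<^bsub>G n\<^esub> y n"
  using assms(2) by (subst inv_product_group) (auto simp: component.is_group)

lemma dst_one_mult_inv:
  assumes "x \<in> carrier (product_group UNIV G)" "y \<in> carrier (product_group UNIV G)"
  shows "dst n ((x \<otimes>\<^bsub>product_group UNIV G\<^esub> inv\<^bsub>product_group UNIV G\<^esub> y) n) \<one>\<^bsub>G n\<^esub>
    = dst n (x n) (y n)"
  using component_closed[OF assms(1)] component_closed[OF assms(2)]
  unfolding mult_inv_component[OF assms] by (simp add: component.gdist_def)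

text \<open>If W_k contains no ball around the identity for any \<open>k\<close>, then no W_k
  contains a ball around any point: the centre is moved by a small factor when it lies in W_k
  itself.\<close>

lemma not_near_in_ball:
  assumes small: "\<And>N r. r > 0 \<Longrightarrow> \<exists>y \<in> carrier (product_group UNIV G).
      eventually (\<lambda>n. dst n (y n) \<one>\<^bsub>G n\<^esub> < r) U \<and> \<not> near N y"
    and x: "x \<in> carrier (product_group UNIV G)" and "r > 0"
  obtains x' where "x' \<in> carrier (product_group UNIV G)"
    "eventually (\<lambda>n. dst n (x' n) (x n) < r) U" "\<not> near k x'"
proof (cases "near k x")
  case False
  show thesis
    by (rule that[OF x _ False]) (simp add: component_closed[OF x] \<open>r > 0\<close>)
next
  case True
  \<comment> \<open>The small factor is taken outside W_(k+k): if both \<open>x\<close> and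
    \<open>y\<close> times \<open>x\<close> were in W_k, their quotient \<open>y\<close> would be in
    W_(k+k).\<close>
  obtain y where y: "y \<in> carrier (product_group UNIV G)"
      "eventually (\<lambda>n. dst n (y n) \<one>\<^bsub>G n\<^esub> < r) U" "\<not> near (k + k) y"
    using small[OF \<open>r > 0\<close>] by blast
  let ?x = "y \<otimes>\<^bsub>product_group UNIV G\<^esub> x"
  have x': "?x \<in> carrier (product_group UNIV G)"
    by (rule P.m_closed[OF y(1) x])
  have y_eq: "?x \<otimes>\<^bsub>product_group UNIV G\<^esub> inv\<^bsub>product_group UNIV G\<^esub> x = y"
    by (rule P.inv_solve_right'[THEN iffD2]) (use x y x' in auto)
  show thesis
  proof (rule that[OF x'])
    show "eventually (\<lambda>n. dst n (?x n) (x n) < r) U"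
      using y(2) dst_one_mult_inv[OF x' x] unfolding y_eq by simp
    show "\<not> near k ?x"
      using near_mult[OF _ near_inv[OF True x] x' P.inv_closed[OF x], of k] y(3)
      unfolding y_eq by blast
  qed
qed

lemma near_ball:
  assumes perfect: "perfect_group (metric_ultraproduct G nrm U)"
  obtains N r where "r > 0"
    "\<And>y. y \<in> carrier (product_group UNIV G) \<Longrightarrow>
      eventually (\<lambda>n. dst n (y n) \<one>\<^bsub>G n\<^esub> < r) U \<Longrightarrow> near N y"
proof (rule ccontr)
  assume "\<not> thesis"
  with that have small: "\<exists>y \<in> carrier (product_group UNIV G).
      eventually (\<lambda>n. dst n (y n) \<one>\<^bsub>G n\<^esub> < r) U \<and> \<not> near N y" if "r > 0" for N r
    using that by blast
  \<comment> \<open>A pair is a ball, given by centre and radius. \<open>A\<close> puts the centre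
    two radii away from W_k, so that points of the ball remain one radius away; \<open>B\<close>
    says that the ball \<open>t\<close> lies in the ball \<open>s\<close> for
    \<open>U\<close>-almost all \<open>n\<close>.\<close>
  define A where "A k s \<longleftrightarrow> fst s \<in> carrier (product_group UNIV G) \<and> snd s > 0 \<and>
      eventually (far k (2 * snd s) (fst s)) U" for k and s :: "(nat \<Rightarrow> 'a) \<times> real"
  define B where "B s t \<longleftrightarrow> eventually (\<lambda>n. dst n (fst t n) (fst s n) + snd t \<le> snd s) U"
    for s t :: "(nat \<Rightarrow> 'a) \<times> real"
  have step: "\<exists>t. A k t \<and> B s t"
    if s: "fst s \<in> carrier (product_group UNIV G)" "snd s > 0" for k s
  proof -
    obtain x' where x': "x' \<in> carrier (product_group UNIV G)"
      "eventually (\<lambda>n. dst n (x' n) (fst s n) < snd s / 2) U" "\<not> near k x'"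
      using not_near_in_ball[OF small s(1), of "snd s / 2" k] s(2) by auto
    obtain \<rho> where \<rho>: "\<rho> > 0" "eventually (far k \<rho> x') U"
      using far_if_not_near[OF x'(1,3)] by blast
    \<comment> \<open>Half of \<open>\<rho>\<close> provides the two radii of distance required by
      \<open>A\<close>; half of the old radius, together with the distance between the centres,
      provides the nesting.\<close>
    let ?t = "(x', min (\<rho> / 2) (snd s / 2))"
    have "eventually (far k (2 * snd ?t) x') U"
      using \<rho>(2) by eventually_elim (force simp: far_def)
    moreover have "B s ?t"
      unfolding B_def using x'(2) by eventually_elim auto
    ultimately show ?thesis
      using x'(1) \<rho>(1) s(2) by (intro exI[of _ ?t]) (auto simp: A_def)
  qed
  have "\<exists>f. \<forall>k. A k (f k) \<and> B (f k) (f (Suc k))"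
  proof (rule dependent_nat_choice)
    show "\<exists>s. A 0 s"
      using step[of "(\<one>\<^bsub>product_group UNIV G\<^esub>, 1)" 0] P.one_closed by auto
  qed (use step in \<open>auto simp: A_def\<close>)
  then obtain f where f: "\<And>k. A k (f k)" "\<And>k. B (f k) (f (Suc k))" by blast
  define x where "x k = fst (f k)" for k
  define \<rho> where "\<rho> k = snd (f k)" for k
  have x: "x k \<in> carrier (product_group UNIV G)" and \<rho>: "\<rho> k > 0"
    and far: "eventually (far k (2 * \<rho> k) (x k)) U"
    and nested: "eventually (\<lambda>n. dst n (x (Suc k) n) (x k n) + \<rho> (Suc k) \<le> \<rho> k) U" for k
    using f[of k] by (simp_all add: A_def B_def x_def \<rho>_def)
  have ball: "eventually (\<lambda>n. dst n (x k n) (x j n) + \<rho> k \<le> \<rho> j) U" if "j \<le> k" for j k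
    using that
  proof (induction k rule: dec_induct)
    case base
    then show ?case by (simp add: component_closed[OF x])
  next
    case (step k)
    from step.IH nested[of k] show ?case
    proof eventually_elim
      case (elim n)
      with component.gdist_triangle[OF component_closed[OF x] component_closed[OF x]
          component_closed[OF x], of n "Suc k" j k]
      show ?case by linarith
    qed
  qed
  \<comment> \<open>A point of W_j is at least \<open>2 * \<rho> j\<close> from the
    \<open>j\<close>-th centre, while all later centres are within \<open>\<rho> j\<close> of it. So
    every later centre keeps the distance \<open>\<rho> j\<close>.\<close>
  have "eventually (far j (\<rho> j) (x k)) U" if "j \<le> k" for j k
    using far[of j] ball[OF that]
  proof eventually_elim
    case (elim n)
    show ?case
      unfolding far_def
    proof (intro allI impI)
      fix w assume w: "product_of_commutators (G n) j w"
      have "dst n w (x j n) \<le> dst n w (x k n) + dst n (x k n) (x j n)"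
        by (intro component.gdist_triangle component.product_of_commutators_closed[OF w]
            component_closed[OF x])
      moreover have "2 * \<rho> j \<le> dst n w (x j n)"
        using elim(1) w by (simp add: far_def)
      ultimately show "\<rho> j \<le> dst n w (x k n)"
        using elim(2) \<rho>[of k] by linarith
    qed
  qed
  then have "\<not> perfect_group (metric_ultraproduct G nrm U)"
    by (rule not_perfect_if_far[OF x \<rho>])
  with perfect show False by contradiction
qed

text \<open>Otherwise some \<open>w\<close> in W_j is within \<open>r\<close> of \<open>x\<close>
  for \<open>U\<close>-almost all \<open>n\<close>. The quotient of \<open>x\<close> by
  \<open>w\<close> then lies in the ball, hence in W_N, and multiplying back by \<open>w\<close>
  puts \<open>x\<close> in W_(N+j).\<close>

lemma far_outside:
  assumes ball: "\<And>y. y \<in> carrier (product_group UNIV G) \<Longrightarrow>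
      eventually (\<lambda>n. dst n (y n) \<one>\<^bsub>G n\<^esub> < r) U \<Longrightarrow> near N y"
    and x: "x \<in> carrier (product_group UNIV G)" and not_near: "\<not> near (N + j) x"
  shows "eventually (far j r x) U"
proof (rule ccontr)
  assume "\<not> eventually (far j r x) U"
  then have ev: "eventually (\<lambda>n. \<not> far j r x n) U"
    by (simp add: eventually_not_iff)
  \<comment> \<open>Where \<open>x\<close> is far, the identity serves as \<open>w\<close>, so that
    the choice is defined in every coordinate.\<close>
  have "\<exists>w. product_of_commutators (G n) j w \<and> (\<not> far j r x n \<longrightarrow> dst n w (x n) < r)" for n
    using component.product_of_commutators_one[of n j] by (auto simp: far_def not_le)
  then obtain w where w: "\<And>n. product_of_commutators (G n) j (w n)"
      "\<And>n. \<not> far j r x n \<Longrightarrow> dst n (w n) (x n) < r"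
    by metis
  have wc: "w \<in> carrier (product_group UNIV G)"
    by (rule representative_closed[OF w(1)])
  let ?y = "x \<otimes>\<^bsub>product_group UNIV G\<^esub> inv\<^bsub>product_group UNIV G\<^esub> w"
  have y: "?y \<in> carrier (product_group UNIV G)"
    by (intro P.m_closed P.inv_closed x wc)
  have "eventually (\<lambda>n. dst n (?y n) \<one>\<^bsub>G n\<^esub> < r) U"
    using ev
  proof eventually_elim
    case (elim n)
    then show ?case
      using w(2)[OF elim] component.gdist_commute[OF component_closed[OF x] component_closed[OF wc]]
      unfolding dst_one_mult_inv[OF x wc] by simp
  qed
  then have "near N ?y" by (rule ball[OF y])
  moreover have "near j w" using w(1) near_iff_representative by blast
  ultimately have "near (N + j) (?y \<otimes>\<^bsub>product_group UNIV G\<^esub> w)"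
    by (rule near_mult[OF _ _ y wc])
  also have "?y \<otimes>\<^bsub>product_group UNIV G\<^esub> w = x"
    using P.inv_solve_right[OF y x wc] by simp
  finally show False using not_near by simp
qed

lemma uniformly_perfect_if_perfect:
  assumes perfect: "perfect_group (metric_ultraproduct G nrm U)"
  shows "uniformly_perfect_group (metric_ultraproduct G nrm U)"
proof (rule ccontr)
  assume not_unif: "\<not> uniformly_perfect_group (metric_ultraproduct G nrm U)"
  obtain N r where "r > 0" and ball: "\<And>y. y \<in> carrier (product_group UNIV G) \<Longrightarrow>
      eventually (\<lambda>n. dst n (y n) \<one>\<^bsub>G n\<^esub> < r) U \<Longrightarrow> near N y"
    by (rule near_ball[OF perfect]) blast
  have "\<exists>x \<in> carrier (product_group UNIV G). \<not> near (N + k) x" for k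
    using not_unif unfolding uniformly_perfect_group_def cls_surj[symmetric] by blast
  then have "\<exists>x. \<forall>k. x k \<in> carrier (product_group UNIV G) \<and> \<not> near (N + k) (x k)"
    by (intro choice) blast
  then obtain x where x: "\<And>k. x k \<in> carrier (product_group UNIV G)" "\<And>k. \<not> near (N + k) (x k)"
    by blast
  \<comment> \<open>Being outside W_(N+k) implies being outside W_(N+j) for
    \<open>j \<le> k\<close>, so the single constant \<open>r\<close> works for all
    \<open>j\<close>.\<close>
  have "eventually (far j r (x k)) U" if "j \<le> k" for j k
  proof (rule far_outside[OF ball x(1)])
    show "\<not> near (N + j) (x k)"
      using x(2)[of k] cls.H.product_of_commutators_mono that by (metis add_left_mono)
  qed
  then have "\<not> perfect_group (metric_ultraproduct G nrm U)"
    by (rule not_perfect_if_far[OF x(1) \<open>r > 0\<close>])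
  with perfect show False by contradiction
qed

end

theorem corollary3p3:
  fixes G :: "nat \<Rightarrow> ('a, 'b) monoid_scheme"
    and nrm :: "nat \<Rightarrow> 'a \<Rightarrow> ennreal"
    and U :: "nat filter"
  assumes "\<And>n. metric_group (G n) (nrm n)"
    and "Sup {nrm n g | n g. g \<in> carrier (G n)} < \<infinity>"
    and "nonprincipal_ultrafilter U"
    and "perfect_group (metric_ultraproduct G nrm U)"
  shows "uniformly_perfect_group (metric_ultraproduct G nrm U)"
proof -
  \<comment> \<open>The common bound makes every norm finite, as the real-valued distance
    requires.\<close>
  have "nrm n g < \<infinity>" if "g \<in> carrier (G n)" for n g
  proof -
    have "nrm n g \<le> Sup {nrm n g | n g. g \<in> carrier (G n)}"
      using that by (intro Sup_upper) blast
    with assms(2) show ?thesis by (rule le_less_trans[rotated])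
  qed
  then have "finite_metric_group_seq G nrm U"
    using assms(1,3)
    by (intro finite_metric_group_seq.intro finite_metric_group.intro finite_metric_group_axioms.intro)
  then show ?thesis
    using assms(4) by (rule finite_metric_group_seq.uniformly_perfect_if_perfect)
qed

end
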